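(* Let $k\ge 1$ be a constant, independent of the number $n$ of robots ($k=\mathcal O(1)$). Starting from any initial configuration $C_0\in\mathcal C_\odot$, there exists no algorithm (even one allowed to depend on $n$) that solves \textsc{Visit-All} in $k$ steps from $C_0$. This holds even if the system has chirality.
   Context: Model. There are $n\ge 2$ robots $r_0,\dots,r_{n-1}$, which are points in $\mathbb R^2$. A configuration is a tuple $C=(p_0,\dots,p_{n-1})$ of points, $p_i$ being the position of $r_i$ in a fixed global coordinate system unknown to the robots; an initial configuration consists of pairwise distinct points. Each robot $r_i$ has a local Cartesian coordinate system $Z_i$, always centred at its current position, whose orientation and unit length are fixed over time but arbitrary and possibly different for different robots. Chirality: all $Z_i$ have the same handedness (the robots agree on the clockwise direction). Robots are anonymous, oblivious and deterministic: an algorithm $\mathcal A$ is one function, the same for all robots, mapping a snapshot (the multiset of positions of all robots expressed in the observing robot's local coordinate system, its own position being the origin) to a destination point (in the same local coordinates). In each round all robots simultaneously take a snapshot, compute their destination, and move exactly to it. Thus $C_0$ and $Z=(Z_0,\dots,Z_{n-1})$ determine the run $(C_0,C_1,C_2,\dots)$ of $\mathcal A$. Permutations. For a permutation $\pi$ of $\{0,\dots,n-1\}$ put $\pi(C)=(p_{\pi(0)},\dots,p_{\pi(n-1)})$. $\Pi_n$ is the set of permutations that are a single $n$-cycle. Problem. For $k\ge 1$, $\mathcal A$ solves \textsc{Visit-All} in $k$ steps from $C_0$ if for every admissible $Z$ the run $(C_0,C_1,\dots)$ has the following property: for every $j\ge 0$ there is $\pi\in\Pi_n$ with $C_{j+ik}=\pi^i(C_j)$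 for all $i\ge 0$. (As the robots are oblivious, every reached configuration $C_j$ counts as an initial configuration, from which the algorithm must also be correct.) $\mathcal C_\odot$ is the set of configurations $C$ having exactly one robot $r_c$ (the central robot) at the centre of the smallest circle enclosing $C$, and such that for some integer $m>1$ the rotation by $2\pi/m$ about the position of $r_c$ maps the multiset of points of $C$ to itself (so $n\ge 3$). *)

theory Defs
  imports "HOL-Analysis.Analysis" "HOL-Combinatorics.Orbits"
begin

text \<open>
  The plane is identified with the complex numbers. A configuration of \<open>n\<close> robots is a function
  \<open>C :: nat \<Rightarrow> complex\<close> of which only the values \<open>C i\<close> with \<open>i < n\<close> are relevant.
\<close>

type_synonym config = "nat \<Rightarrow> complex"

definition points :: "nat \<Rightarrow> config \<Rightarrow> complex multiset" where
  "points n C = image_mset C (mset_set {..<n})"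

definition initial_config :: "nat \<Rightarrow> config \<Rightarrow> bool" where
  "initial_config n C \<longleftrightarrow> inj_on C {..<n}"


subsection \<open>Local coordinate systems\<close>

text \<open>
  A Cartesian coordinate system up to its centre: the angle of the positive x-axis, the unit
  length, and the handedness (relative to the global coordinate system).
\<close>

datatype frame = Frame (orientation: real) (unit_length: real) (right_handed: bool)

text \<open>The global displacement vector of the local point \<open>(1, 0)\<close>.\<close>

definition x_axis :: "frame \<Rightarrow> complex" where
  "x_axis Z = of_real (unit_length Z) * cis (orientation Z)"

text \<open>
  The global displacement vector of the local point \<open>(0, 1)\<close> is \<open>\<i> * x_axis Z\<close> in a right-handed
  frame and \<open>- \<i> * x_axis Z\<close> in a left-handed one; hence the conjugations below.
\<close>

definition to_global :: "frame \<Rightarrow> complex \<Rightarrow> complex \<Rightarrow> complex" where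
  "to_global Z p w = p + x_axis Z * (if right_handed Z then w else cnj w)"

definition to_local :: "frame \<Rightarrow> complex \<Rightarrow> complex \<Rightarrow> complex" where
  "to_local Z p q = (if right_handed Z then (q - p) / x_axis Z else cnj ((q - p) / x_axis Z))"

lemma to_global_to_local:
  assumes "unit_length Z > 0"
  shows "to_global Z p (to_local Z p q) = q" and "to_local Z p (to_global Z p w) = w"
  using assms by (auto simp: to_global_def to_local_def x_axis_def cis_neq_zero)

text \<open>Chirality: the handedness is arbitrary but common to all robots.\<close>

definition admissible :: "nat \<Rightarrow> (nat \<Rightarrow> frame) \<Rightarrow> bool" where
  "admissible n Z \<longleftrightarrow>
     (\<forall>i<n. unit_length (Z i) > 0) \<and>
     (\<forall>i<n. \<forall>j<n. right_handed (Z i) = right_handed (Z j))"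


subsection \<open>Algorithms and runs\<close>

text \<open>
  An algorithm maps a snapshot, in local coordinates with the observing robot at the origin, to a
  destination in the same local coordinates.
\<close>

type_synonym algorithm = "complex multiset \<Rightarrow> complex"

definition snapshot :: "nat \<Rightarrow> frame \<Rightarrow> complex \<Rightarrow> config \<Rightarrow> complex multiset" where
  "snapshot n Z p C = image_mset (to_local Z p) (points n C)"

definition one_round :: "nat \<Rightarrow> algorithm \<Rightarrow> (nat \<Rightarrow> frame) \<Rightarrow> config \<Rightarrow> config" where
  "one_round n A Z C = (\<lambda>i. to_global (Z i) (C i) (A (snapshot n (Z i) (C i) C)))"

definition run :: "nat \<Rightarrow> algorithm \<Rightarrow> (nat \<Rightarrow> frame) \<Rightarrow> config \<Rightarrow> nat \<Rightarrow> config" where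
  "run n A Z C0 t = (one_round n A Z ^^ t) C0"


subsection \<open>The problem Visit-All\<close>

definition full_cycles :: "nat \<Rightarrow> (nat \<Rightarrow> nat) set" where
  "full_cycles n = {\<pi>. \<pi> permutes {..<n} \<and> cyclic_on \<pi> {..<n}}"

definition solves_visit_all :: "nat \<Rightarrow> nat \<Rightarrow> algorithm \<Rightarrow> config \<Rightarrow> bool" where
  "solves_visit_all n k A C0 \<longleftrightarrow>
     (\<forall>Z. admissible n Z \<longrightarrow>
       (\<forall>j. \<exists>\<pi>\<in>full_cycles n. \<forall>i. \<forall>r<n.
          run n A Z C0 (j + i * k) r = run n A Z C0 j ((\<pi> ^^ i) r)))"


subsection \<open>Rotationally symmetric configurations with a central robot\<close>

definition smallest_enclosing_circle :: "complex set \<Rightarrow> complex \<Rightarrow> real \<Rightarrow> bool" where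
  "smallest_enclosing_circle S z \<rho> \<longleftrightarrow>
     S \<subseteq> cball z \<rho> \<and> (\<forall>z' \<rho>'. S \<subseteq> cball z' \<rho>' \<longrightarrow> \<rho> \<le> \<rho>')"

definition rotation_about :: "complex \<Rightarrow> real \<Rightarrow> complex \<Rightarrow> complex" where
  "rotation_about z \<theta> q = z + cis \<theta> * (q - z)"

definition C_odot :: "nat \<Rightarrow> config set" where
  "C_odot n = {C. \<exists>c<n. (\<exists>\<rho>. smallest_enclosing_circle (C ` {..<n}) (C c) \<rho>) \<and>
     (\<forall>i<n. C i = C c \<longrightarrow> i = c) \<and>
     (\<exists>m::nat. m > 1 \<and>
        image_mset (rotation_about (C c) (2 * pi / real m)) (points n C) = points n C)}"

end

theory Submission
  imports Defs "HOL-Combinatorics.Cycles"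
begin

text \<open>
  Let every robot use one of two frames \<open>f\<close> and \<open>g\<close>. If all use \<open>f\<close>, robots that meet stay together
  forever, so no two of them ever meet. Now give \<open>g\<close> to a single robot. After \<open>k\<close> rounds the same
  set of points is occupied, but the frame \<open>g\<close> has moved to another point \<open>y\<close> instead of \<open>x\<close>; since
  the next round must produce the same multiset of points in both cases, the destinations satisfy
  \<open>{D(x,g), D(y,f)} = {D(x,f), D(y,g)}\<close>, and \<open>D(x,f) \<noteq> D(y,f)\<close> forces \<open>D(x,f) = D(x,g)\<close>. So no
  destination depends on the choice between \<open>f\<close> and \<open>g\<close>. Taking for \<open>g\<close> the frame \<open>f\<close> rotated by the
  symmetry angle, each round commutes with the symmetry, and hence the central robot never moves.
\<close>

text \<open>The target depends on the occupied multiset, the frame and the position, but not on the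
  robot's index or the past: anonymity and obliviousness enter here.\<close>

definition destination :: "algorithm \<Rightarrow> complex multiset \<Rightarrow> frame \<Rightarrow> complex \<Rightarrow> complex" where
  "destination A M Z p = to_global Z p (A (image_mset (to_local Z p) M))"

lemma one_round_eq: "one_round n A Z C i = destination A (points n C) (Z i) (C i)"
  by (simp add: one_round_def destination_def snapshot_def)

lemma run_0 [simp]: "run n A Z C 0 = C"
  by (simp add: run_def)

lemma run_Suc: "run n A Z C (Suc t) i = destination A (points n (run n A Z C t)) (Z i) (run n A Z C t i)"
  by (simp add: run_def one_round_eq)

lemma points_cong: "(\<And>i. i < n \<Longrightarrow> C i = D i) \<Longrightarrow> points n C = points n D"
  unfolding points_def by (intro image_mset_cong) auto

lemma points_permute:
  assumes "\<pi> permutes {..<n}"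
  shows "points n (\<lambda>i. C (\<pi> i)) = points n C"
proof -
  have "image_mset \<pi> (mset_set {..<n}) = mset_set {..<n}"
    using assms by (simp add: image_mset_mset_set permutes_inj_on permutes_image)
  then have "image_mset C (image_mset \<pi> (mset_set {..<n})) = image_mset C (mset_set {..<n})"
    by (rule arg_cong)
  then show ?thesis
    by (simp add: points_def image_mset.compositionality comp_def)
qed

text \<open>One extra point on each side makes it possible to replace a point without multiset
  subtraction.\<close>

lemma points_fun_upd:
  assumes "i < n"
  shows "add_mset (C i) (points n (C(i := p))) = add_mset p (points n C)"
proof -
  have "mset_set {..<n} = add_mset i (mset_set ({..<n} - {i}))"
    using assms by (simp add: mset_set.remove)
  moreover have "image_mset (C(i := p)) (mset_set ({..<n} - {i})) = image_mset C (mset_set ({..<n} - {i}))"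
    by (intro image_mset_cong) auto
  ultimately show ?thesis
    by (simp add: points_def)
qed

text \<open>The orbit of a fixed point is a singleton, whereas a full cycle makes it all of
  \<open>{..<n}\<close>.\<close>

lemma full_cycles_moves:
  assumes "\<pi> \<in> full_cycles n" and "n \<ge> 2" and "i < n"
  shows "\<pi> i \<noteq> i"
proof
  assume fixed: "\<pi> i = i"
  have "cyclic_on \<pi> {..<n}"
    using assms(1) by (simp add: full_cycles_def)
  with \<open>i < n\<close> have orbit: "orbit \<pi> i = {..<n}"
    by (simp add: orbit_cyclic_eq3)
  have "x = i" if "x \<in> orbit \<pi> i" for x
    using that by induction (simp_all add: fixed)
  then have "0 = i" "1 = i"
    using \<open>n \<ge> 2\<close> unfolding orbit by auto
  then show False by simp
qed

lemma solves_visit_allD: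
  assumes "solves_visit_all n k A C0" and "admissible n Z"
  obtains \<pi> where "\<pi> \<in> full_cycles n"
    and "\<forall>i. \<forall>r<n. run n A Z C0 (j + i * k) r = run n A Z C0 j ((\<pi> ^^ i) r)"
  using assms unfolding solves_visit_all_def by blast

lemma run_together:
  assumes "run n A Z C s i = run n A Z C s j" and "Z i = Z j" and "s \<le> t"
  shows "run n A Z C t i = run n A Z C t j"
  using assms(3) by (induction t rule: dec_induct) (simp_all add: assms run_Suc)

lemma run_inj_on:
  assumes solves: "solves_visit_all n k A C0" and "k \<ge> 1" and "initial_config n C0"
    and Z: "admissible n Z" "\<And>i. Z i = f"
  shows "inj_on (run n A Z C0 t) {..<n}"
proof (rule inj_onI)
  fix i j assume ij: "i \<in> {..<n}" "j \<in> {..<n}" and eq: "run n A Z C0 t i = run n A Z C0 t j"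
  obtain \<pi> where \<pi>: "\<pi> \<in> full_cycles n"
    and ret: "\<forall>i. \<forall>r<n. run n A Z C0 (0 + i * k) r = run n A Z C0 0 ((\<pi> ^^ i) r)"
    using solves_visit_allD[OF solves Z(1), where j = 0] by blast
  have perm: "\<pi> ^^ t permutes {..<n}"
    using \<pi> by (simp add: full_cycles_def permutes_funpow)
  \<comment> \<open>The time \<open>t * k\<close> is not before \<open>t\<close>, so the robots are
    still together, and it is a multiple of \<open>k\<close>, so the positions are those of
    \<open>C0\<close> permuted.\<close>
  have "run n A Z C0 (t * k) i = run n A Z C0 (t * k) j"
    by (rule run_together[OF eq]) (use \<open>k \<ge> 1\<close> Z(2) in auto)
  then have "C0 ((\<pi> ^^ t) i) = C0 ((\<pi> ^^ t) j)"
    using ret ij by simp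
  moreover have "(\<pi> ^^ t) i \<in> {..<n}" "(\<pi> ^^ t) j \<in> {..<n}"
    using perm ij by (simp_all only: permutes_in_image)
  ultimately have "(\<pi> ^^ t) i = (\<pi> ^^ t) j"
    using \<open>initial_config n C0\<close> unfolding initial_config_def by (meson inj_onD)
  then show "i = j"
    using permutes_inj[OF perm] by (meson injD)
qed

text \<open>Hypothesis \<open>C\<close> says that the choice between \<open>f\<close> and
  \<open>g\<close> does not affect the positions at time \<open>t\<close>; the conclusion carries
  this over to the next round.\<close>

lemma destination_frame_independent:
  assumes solves: "solves_visit_all n k A C0" and "n \<ge> 2" "k \<ge> 1" "initial_config n C0"
    and adm: "\<And>Z. (\<And>i. Z i \<in> {f, g}) \<Longrightarrow> admissible n Z"
    and C: "\<And>Z i. (\<And>i. Z i \<in> {f, g}) \<Longrightarrow> i < n \<Longrightarrow> run n A Z C0 t i = C i"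
    and "i < n"
  shows "destination A (points n C) g (C i) = destination A (points n C) f (C i)"
proof -
  define Z where "Z = (\<lambda>_. f)(i := g)"
  have Z: "admissible n Z" "\<And>i. i < n \<Longrightarrow> run n A Z C0 t i = C i"
    by (rule adm, simp add: Z_def) (rule C, simp_all add: Z_def)
  \<comment> \<open>In \<open>E\<close> and \<open>E'\<close> the index \<open>j\<close> labels the
    place \<open>C j\<close>, whichever robot stands there.\<close>
  define E where "E = (\<lambda>j. destination A (points n C) f (C j))"
  define E' where "E' = (\<lambda>j. destination A (points n C) g (C j))"
  have inj: "inj_on E {..<n}"
  proof -
    have "inj_on (run n A (\<lambda>_. f) C0 (Suc t)) {..<n}"
      by (rule run_inj_on[OF solves \<open>k \<ge> 1\<close> \<open>initial_config n C0\<close>]) (auto intro: adm)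
    moreover have "run n A (\<lambda>_. f) C0 (Suc t) j = E j" if "j < n" for j
      using that C[of "\<lambda>_. f"] points_cong[of n "run n A (\<lambda>_. f) C0 t" C]
      by (simp add: run_Suc E_def)
    ultimately show ?thesis by (simp add: inj_on_def)
  qed
  obtain \<pi> where \<pi>: "\<pi> \<in> full_cycles n"
    and ret: "\<forall>m. \<forall>r<n. run n A Z C0 (t + m * k) r = run n A Z C0 t ((\<pi> ^^ m) r)"
    using solves_visit_allD[OF solves Z(1), where j = t] by blast
  \<comment> \<open>The permutation may change with the starting time; \<open>\<sigma>\<close>
    serves to equate the multisets at \<open>Suc t\<close> and \<open>Suc (t + k)\<close>.\<close>
  obtain \<sigma> where \<sigma>: "\<sigma> \<in> full_cycles n"
    and ret': "\<forall>m. \<forall>r<n. run n A Z C0 (Suc t + m * k) r = run n A Z C0 (Suc t) ((\<sigma> ^^ m) r)"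
    using solves_visit_allD[OF solves Z(1), where j = "Suc t"] by blast
  have perm: "\<pi> permutes {..<n}" "\<sigma> permutes {..<n}"
    using \<pi> \<sigma> by (simp_all add: full_cycles_def)
  have \<pi>_less: "\<pi> r < n" if "r < n" for r
    using permutes_in_image[OF perm(1), of r] that by simp
  have step: "run n A Z C0 (Suc t) r = (E(i := E' i)) r" if "r < n" for r
    using that Z(2) points_cong[of n "run n A Z C0 t" C]
    by (simp add: run_Suc E_def E'_def Z_def)
  have later: "run n A Z C0 (t + k) r = C (\<pi> r)" if "r < n" for r
    using ret[rule_format, of r 1] Z(2) \<pi>_less that by simp
  have "points n (run n A Z C0 (t + k)) = points n C"
    using points_cong[of n, OF later] points_permute[OF perm(1)] by simp
  \<comment> \<open>Robot \<open>i\<close>, the one using \<open>g\<close>, now stands at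
    \<open>C (\<pi> i)\<close>, so the update moves to index \<open>\<pi> i\<close>.\<close>
  then have "run n A Z C0 (Suc (t + k)) r = (E(\<pi> i := E' (\<pi> i))) (\<pi> r)" if "r < n" for r
    using that later permutes_inj[OF perm(1)]
    by (auto simp: run_Suc E_def E'_def Z_def dest: injD)
  then have "points n (run n A Z C0 (Suc (t + k))) = points n (E(\<pi> i := E' (\<pi> i)))"
    using points_cong[of n "run n A Z C0 (Suc (t + k))" "\<lambda>r. (E(\<pi> i := E' (\<pi> i))) (\<pi> r)"]
      points_permute[OF perm(1), of "E(\<pi> i := E' (\<pi> i))"]
    by simp
  moreover have "points n (run n A Z C0 (Suc (t + k))) = points n (run n A Z C0 (Suc t))"
    using points_cong[of n "run n A Z C0 (Suc (t + k))" "\<lambda>r. run n A Z C0 (Suc t) (\<sigma> r)"]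
      ret'[rule_format, of _ 1] points_permute[OF perm(2), of "run n A Z C0 (Suc t)"]
    by simp
  ultimately have "points n (E(i := E' i)) = points n (E(\<pi> i := E' (\<pi> i)))"
    using points_cong[of n "run n A Z C0 (Suc t)" "E(i := E' i)", OF step] by (simp only:)
  \<comment> \<open>The points \<open>E i\<close> and \<open>E (\<pi> i)\<close> overwritten by the
    two updates are added to both sides.\<close>
  then have "add_mset (E (\<pi> i)) (add_mset (E' i) (points n E))
      = add_mset (E i) (add_mset (E' (\<pi> i)) (points n E))"
    using points_fun_upd[OF \<open>i < n\<close>, of E "E' i"]
      points_fun_upd[OF \<pi>_less[OF \<open>i < n\<close>], of E "E' (\<pi> i)"]
    by (metis add_mset_commute)
  then have "{#E (\<pi> i), E' i#} + points n E = {#E i, E' (\<pi> i)#} + points n E"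
    by simp
  then have "{#E (\<pi> i), E' i#} = {#E i, E' (\<pi> i)#}"
    by (simp only: add_right_cancel)
  moreover have "E (\<pi> i) \<noteq> E i"
    using full_cycles_moves[OF \<pi> \<open>n \<ge> 2\<close> \<open>i < n\<close>] inj \<open>i < n\<close> \<pi>_less[OF \<open>i < n\<close>]
    by (auto dest: inj_onD)
  \<comment> \<open>The left pair must contain \<open>E i\<close>, which is not
    \<open>E (\<pi> i)\<close>.\<close>
  ultimately have "E' i = E i"
    by (auto simp: add_eq_conv_ex)
  then show ?thesis by (simp add: E_def E'_def)
qed

text \<open>A robot whose position and frame are both turned by \<open>\<theta>\<close> gets the
  same snapshot of the symmetric \<open>M\<close>, hence the same local target.\<close>

lemma destination_rotation:
  assumes "image_mset (rotation_about z \<theta>) M = M"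
  shows "destination A M (Frame (\<alpha> + \<theta>) u h) (rotation_about z \<theta> p)
    = rotation_about z \<theta> (destination A M (Frame \<alpha> u h) p)"
proof -
  have axis: "x_axis (Frame (\<alpha> + \<theta>) u h) = cis \<theta> * x_axis (Frame \<alpha> u h)" for h
    by (simp add: x_axis_def cis_mult[symmetric])
  have diff: "rotation_about z \<theta> q - rotation_about z \<theta> p = cis \<theta> * (q - p)" for q
    by (simp add: rotation_about_def algebra_simps)
  have "to_local (Frame (\<alpha> + \<theta>) u h) (rotation_about z \<theta> p) (rotation_about z \<theta> q)
      = to_local (Frame \<alpha> u h) p q" for q
    by (simp add: to_local_def axis diff cis_neq_zero)
  then have "image_mset (to_local (Frame (\<alpha> + \<theta>) u h) (rotation_about z \<theta> p))
        (image_mset (rotation_about z \<theta>) M) = image_mset (to_local (Frame \<alpha> u h) p) M"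
    by (simp add: image_mset.compositionality comp_def)
  then have "image_mset (to_local (Frame (\<alpha> + \<theta>) u h) (rotation_about z \<theta> p)) M
      = image_mset (to_local (Frame \<alpha> u h) p) M"
    by (simp add: assms)
  then show ?thesis
    by (simp add: destination_def to_global_def axis rotation_about_def algebra_simps)
qed

lemma rotation_about_fixed:
  assumes "rotation_about z \<theta> p = p" and "cis \<theta> \<noteq> 1"
  shows "p = z"
proof -
  have "(cis \<theta> - 1) * (p - z) = 0"
    using assms(1) by (simp add: rotation_about_def algebra_simps)
  then show ?thesis using assms(2) by simp
qed

lemma cis_fraction_ne_1:
  assumes "m > 1"
  shows "cis (2 * pi / real m) \<noteq> 1"
proof
  assume "cis (2 * pi / real m) = 1"
  then have "cos (2 * pi / real m) = cos 0"
    by (simp add: complex_eq_iff)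
  \<comment> \<open>As \<open>m\<close> is at least 2, the angle lies in the range up to
    \<open>pi\<close> where the cosine strictly decreases.\<close>
  moreover have "cos (2 * pi / real m) < cos 0"
  proof (rule cos_monotone_0_pi)
    show "2 * pi / real m \<le> pi"
      using assms by (simp add: field_simps)
  qed (use assms in auto)
  ultimately show False by simp
qed

text \<open>The induction treats all assignments of \<open>f\<close> and \<open>g\<close> at once,
  since frame independence at time \<open>t\<close> requires a common configuration
  \<open>C\<close>.\<close>

lemma central_robot_stays:
  assumes solves: "solves_visit_all n k A C0" and "n \<ge> 2" "k \<ge> 1" "initial_config n C0"
    and "c < n" and \<theta>: "cis \<theta> \<noteq> 1"
    and sym: "image_mset (rotation_about (C0 c) \<theta>) (points n C0) = points n C0"
    and f: "f = Frame 0 1 True" and g: "g = Frame \<theta> 1 True"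
  shows "\<exists>C. C c = C0 c \<and> image_mset (rotation_about (C0 c) \<theta>) (points n C) = points n C \<and>
    (\<forall>Z. (\<forall>i. Z i \<in> {f, g}) \<longrightarrow> (\<forall>i<n. run n A Z C0 t i = C i))"
proof (induction t)
  case 0
  then show ?case using sym by auto
next
  case (Suc t)
  let ?\<rho> = "rotation_about (C0 c) \<theta>"
  obtain C where Cc: "C c = C0 c" and symC: "image_mset ?\<rho> (points n C) = points n C"
    and C: "\<And>Z i. (\<And>i. Z i \<in> {f, g}) \<Longrightarrow> i < n \<Longrightarrow> run n A Z C0 t i = C i"
    using Suc.IH by blast
  have adm: "admissible n Z" if "\<And>i. Z i \<in> {f, g}" for Z
    using that unfolding admissible_def f g by (metis frame.sel empty_iff insert_iff zero_less_one)
  let ?d = "destination A (points n C) f"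
  have indep: "destination A (points n C) g (C i) = ?d (C i)" if "i < n" for i
    using destination_frame_independent[OF solves \<open>n \<ge> 2\<close> \<open>k \<ge> 1\<close> \<open>initial_config n C0\<close> adm C that]
    by blast
  \<comment> \<open>At the turned point, frame independence replaces \<open>f\<close> by its turned
    copy \<open>g\<close>.\<close>
  have rot: "?d (?\<rho> x) = ?\<rho> (?d x)" if "x \<in># points n C" for x
  proof -
    have "?\<rho> x \<in># points n C"
      using that symC by (metis image_eqI set_image_mset)
    then obtain i where "i < n" "?\<rho> x = C i"
      by (auto simp: points_def)
    then have "?d (?\<rho> x) = destination A (points n C) g (?\<rho> x)"
      using indep by simp
    also have "\<dots> = ?\<rho> (?d x)"
      using destination_rotation[OF symC, of A 0 1 True x] by (simp add: f g)
    finally show ?thesis .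
  qed
  \<comment> \<open>The centre is fixed by \<open>?\<rho>\<close>, hence so is its destination,
    which must then be the centre itself.\<close>
  have "?\<rho> (?d (C0 c)) = ?d (C0 c)"
    using rot[of "C0 c"] Cc[symmetric] \<open>c < n\<close> by (simp add: points_def rotation_about_def)
  then have "?d (C c) = C0 c"
    using rotation_about_fixed[OF _ \<theta>] unfolding Cc by blast
  moreover have "image_mset ?\<rho> (points n (\<lambda>i. ?d (C i))) = points n (\<lambda>i. ?d (C i))"
  proof -
    have image: "points n (\<lambda>i. ?d (C i)) = image_mset ?d (points n C)"
      by (simp add: points_def image_mset.compositionality comp_def)
    have "image_mset ?\<rho> (image_mset ?d (points n C)) = image_mset ?d (image_mset ?\<rho> (points n C))"
      unfolding image_mset.compositionality comp_def by (intro image_mset_cong) (simp add: rot)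
    then show ?thesis by (simp add: image symC)
  qed
  moreover have "run n A Z C0 (Suc t) i = ?d (C i)" if "\<forall>i. Z i \<in> {f, g}" "i < n" for Z i
  proof -
    have "points n (run n A Z C0 t) = points n C"
      using C that(1) by (intro points_cong) simp
    moreover have "Z i = f \<or> Z i = g"
      using that(1) by auto
    ultimately show ?thesis
      using C[of Z i] that indep[of i] by (elim disjE) (simp_all add: run_Suc)
  qed
  ultimately show ?case
    by (intro exI[of _ "\<lambda>i. ?d (C i)"]) blast
qed

theorem theorem5:
  fixes n k :: nat and C0 :: config
  assumes "n \<ge> 2"
    and "k \<ge> 1"
    and "initial_config n C0"
    and "C0 \<in> C_odot n"
  shows "\<not> (\<exists>A :: algorithm. solves_visit_all n k A C0)"
proof
  assume "\<exists>A :: algorithm. solves_visit_all n k A C0"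
  then obtain A :: algorithm where solves: "solves_visit_all n k A C0" ..
  obtain c m where "c < n" and m: "m > 1"
    and sym: "image_mset (rotation_about (C0 c) (2 * pi / real m)) (points n C0) = points n C0"
    using \<open>C0 \<in> C_odot n\<close> unfolding C_odot_def by blast
  define Z where "Z = (\<lambda>_::nat. Frame 0 1 True)"
  have "admissible n Z"
    by (simp add: admissible_def Z_def)
  then obtain \<pi> where \<pi>: "\<pi> \<in> full_cycles n"
    and ret: "\<forall>i. \<forall>r<n. run n A Z C0 (0 + i * k) r = run n A Z C0 0 ((\<pi> ^^ i) r)"
    using solves_visit_allD[OF solves, where j = 0] by blast
  \<comment> \<open>Robot \<open>c\<close> has not moved, yet after \<open>k\<close> rounds it must
    occupy the initial place of robot \<open>\<pi> c\<close>.\<close>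
  have "run n A Z C0 k c = C0 c"
    using central_robot_stays[OF solves \<open>n \<ge> 2\<close> \<open>k \<ge> 1\<close> \<open>initial_config n C0\<close> \<open>c < n\<close>
        cis_fraction_ne_1[OF m] sym refl refl, of k] \<open>c < n\<close>
    unfolding Z_def by fastforce
  then have "C0 (\<pi> c) = C0 c"
    using ret[rule_format, OF \<open>c < n\<close>, of 1] by simp
  moreover have "\<pi> c < n"
    using \<pi> permutes_in_image[of \<pi> "{..<n}" c] \<open>c < n\<close> by (simp add: full_cycles_def)
  ultimately have "\<pi> c = c"
    using \<open>initial_config n C0\<close> \<open>c < n\<close> by (auto simp: initial_config_def dest: inj_onD)
  then show False
    using full_cycles_moves[OF \<pi> \<open>n \<ge> 2\<close> \<open>c < n\<close>] by simp
qed

end
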